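(* Let $M$ be a matroid on a finite ground set $E$ and let $\ell:E\to\mathbb{N}$ and $w:E\to\mathbb{N}$ be functions (list size and weight). Then the following conditions are equivalent: (1) $M$ is $w$-colorable from the lists $L_\ell(e)=\{1,\dots,\ell(e)\}$, $e\in E$; (2) $M$ is $w$-colorable from any lists of size $\ell$, i.e. from every list assignment $L:E\to\mathcal{P}(\mathbb{N})$ with $|L(e)|=\ell(e)$ for all $e\in E$; (3) $M$ is on-line $w$-colorable from lists of size $\ell$. In particular, for every loopless matroid $M$ we have $\mathrm{ch}_{on-line}(M)=\chi(M)$.
   Context: $\mathbb{N}$ contains $0$. For $w:E\to\mathbb{N}$ and a list assignment $L$, $M$ is $w$-colorable from lists $L$ if one can choose for each $e\in E$ a subset $L'(e)\subset L(e)$ with exactly $w(e)$ colors, such that for each color $c$ the set $\{e\in E:c\in L'(e)\}$ is independent in $M$. On-line game: in the $i$-th round ($i=1,2,3,\dots$) Bob picks a non-empty subset $B_i\subset E$ and inserts color $i$ into the lists of all elements of $B_i$ (initially all lists are empty, and the list of an element $e$ may receive at most $\ell(e)$ colors). Then Alice chooses an independent set $A_i\subset B_i$ of $M$ and assigns color $i$ to all elements of $A_i$. The game ends when for each $e\in E$ the list of $e$ has exactly $\ell(e)$ elements. Alice wins if at the end she has obtained a $w$-coloring, i.e. each element $e$ has been assigned $w(e)$ colors. $M$ is on-line $w$-colorable from lists of size $\ell$ if Alice has a winning strategy in this game. For a loopless matroid $M$, the on-line list chromatic number $\mathrm{ch}_{on-line}(M)$ is the minimum $k$ such that Alice has a winning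 strategy in this game with $\ell\equiv k$ and $w\equiv 1$; the chromatic number $\chi(M)$ is the minimum number of independent sets into which $E$ can be partitioned. *)

theory Defs
  imports Main "HOL-Library.Disjoint_Sets"
begin

locale matroid =
  fixes E :: "'a set" and indep :: "'a set \<Rightarrow> bool"
  assumes finite_ground: "finite E"
    and indep_subset_ground: "indep X \<Longrightarrow> X \<subseteq> E"
    and indep_empty: "indep {}"
    and indep_subset: "indep X \<Longrightarrow> Y \<subseteq> X \<Longrightarrow> indep Y"
    and augmentation: "indep X \<Longrightarrow> indep Y \<Longrightarrow> card X < card Y \<Longrightarrow>
      \<exists>y\<in>Y - X. indep (insert y X)"

definition loopless :: "'a set \<Rightarrow> ('a set \<Rightarrow> bool) \<Rightarrow> bool" where
  "loopless E indep \<longleftrightarrow> (\<forall>e\<in>E. indep {e})"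

text \<open>The conjunct \<open>finite (L' e)\<close> is needed because \<open>card\<close> is \<open>0\<close> on infinite sets.\<close>

definition list_colorable ::
  "'a set \<Rightarrow> ('a set \<Rightarrow> bool) \<Rightarrow> ('a \<Rightarrow> nat) \<Rightarrow> ('a \<Rightarrow> nat set) \<Rightarrow> bool" where
  "list_colorable E indep w L \<longleftrightarrow>
    (\<exists>L' :: 'a \<Rightarrow> nat set.
       (\<forall>e\<in>E. L' e \<subseteq> L e \<and> finite (L' e) \<and> card (L' e) = w e) \<and>
       (\<forall>c. indep {e\<in>E. c \<in> L' e}))"

text \<open>
  The moves of either player are recorded as a list of sets \<open>[X\<^sub>1, \<dots>, X\<^sub>n]\<close>, where
  \<open>X\<^sub>i\<close> is the set of elements receiving colour \<open>i\<close>. Applied to the moves of Bob,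
  \<open>colors_of\<close> yields the list of \<open>e\<close>; applied to the moves of Alice, it yields the
  colours assigned to \<open>e\<close>.
\<close>

definition colors_of :: "'a set list \<Rightarrow> 'a \<Rightarrow> nat set" where
  "colors_of Xs e = {Suc i | i. i < length Xs \<and> e \<in> Xs ! i}"

definition bob_legal :: "'a set \<Rightarrow> ('a \<Rightarrow> nat) \<Rightarrow> 'a set list \<Rightarrow> bool" where
  "bob_legal E ell Bs \<longleftrightarrow>
    (\<forall>B\<in>set Bs. B \<noteq> {} \<and> B \<subseteq> E) \<and> (\<forall>e\<in>E. card (colors_of Bs e) \<le> ell e)"

definition game_over :: "'a set \<Rightarrow> ('a \<Rightarrow> nat) \<Rightarrow> 'a set list \<Rightarrow> bool" where
  "game_over E ell Bs \<longleftrightarrow> (\<forall>e\<in>E. card (colors_of Bs e) = ell e)"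

text \<open>
  A strategy of Alice maps Bob's moves \<open>[B\<^sub>1, \<dots>, B\<^sub>i]\<close> up to and including the current
  round to her answer \<open>A\<^sub>i\<close>; her own earlier moves are determined by the strategy and
  the earlier moves of Bob.
\<close>

definition alice_moves :: "('a set list \<Rightarrow> 'a set) \<Rightarrow> 'a set list \<Rightarrow> 'a set list" where
  "alice_moves \<sigma> Bs = map (\<lambda>i. \<sigma> (take (Suc i) Bs)) [0..<length Bs]"

text \<open>
  Every play has at most \<open>\<Sum>e\<in>E. ell e\<close> rounds, so no infinite plays need to be considered.
  Alice has to answer legally in unfinished plays too.
\<close>

definition winning_strategy ::
  "'a set \<Rightarrow> ('a set \<Rightarrow> bool) \<Rightarrow> ('a \<Rightarrow> nat) \<Rightarrow> ('a \<Rightarrow> nat) \<Rightarrow> ('a set list \<Rightarrow> 'a set) \<Rightarrow> bool"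
where
  "winning_strategy E indep w ell \<sigma> \<longleftrightarrow>
    (\<forall>Bs. bob_legal E ell Bs \<longrightarrow>
       list_all2 (\<lambda>A B. A \<subseteq> B \<and> indep A) (alice_moves \<sigma> Bs) Bs \<and>
       (game_over E ell Bs \<longrightarrow> (\<forall>e\<in>E. card (colors_of (alice_moves \<sigma> Bs) e) = w e)))"

definition online_colorable ::
  "'a set \<Rightarrow> ('a set \<Rightarrow> bool) \<Rightarrow> ('a \<Rightarrow> nat) \<Rightarrow> ('a \<Rightarrow> nat) \<Rightarrow> bool" where
  "online_colorable E indep w ell \<longleftrightarrow> (\<exists>\<sigma>. winning_strategy E indep w ell \<sigma>)"

text \<open>The two minima below are attained for loopless matroids; otherwise they are unspecified.\<close>

definition online_list_chromatic_number :: "'a set \<Rightarrow> ('a set \<Rightarrow> bool) \<Rightarrow> nat" where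
  "online_list_chromatic_number E indep =
    (LEAST k. online_colorable E indep (\<lambda>_. 1) (\<lambda>_. k))"

definition chromatic_number :: "'a set \<Rightarrow> ('a set \<Rightarrow> bool) \<Rightarrow> nat" where
  "chromatic_number E indep =
    (LEAST k. \<exists>P. partition_on E P \<and> (\<forall>X\<in>P. indep X) \<and> card P = k)"

end

theory Submission
  imports Defs
begin

text \<open>
  The proof rests on one round of the game. Suppose that the matroid is \<open>w\<close>-colorable from the
  lists \<open>{1..ell e}\<close>; such a coloring consists of independent sets \<open>V\<^sub>i \<subseteq> Q\<^sub>i\<close>, where
  \<open>Q\<^sub>i = {e. i < ell e}\<close> is a decreasing chain and every \<open>e\<close> lies in exactly \<open>w e\<close> of the \<open>V\<^sub>i\<close>.
  When Bob presents a set \<open>B\<close>, the remaining list sizes are \<open>ell - 1\<close> on \<open>B\<close> and \<open>ell\<close> elsewhere, and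
  their chain is \<open>Q'\<^sub>i = (Q\<^sub>i - B) \<union> (Q\<^sub>i\<^sub>+\<^sub>1 \<inter> B)\<close>. The family consisting of \<open>B\<close> and the \<open>Q'\<^sub>i\<close> covers every
  element as often as the \<open>Q\<^sub>i\<close> do. Uncrossing it, by replacing first \<open>B\<close> and \<open>Q'\<^sub>0\<close>, then
  \<open>Q\<^sub>1 \<inter> B\<close> and \<open>Q'\<^sub>1\<close>, and so on, by their union and intersection, leads to the chain of the \<open>Q\<^sub>i\<close>.

  A coloring is carried through these replacements in the opposite direction: if \<open>I \<subseteq> X \<union> Y\<close> and
  \<open>J \<subseteq> X \<inter> Y\<close> are independent, then there are independent sets \<open>I' \<subseteq> X\<close> and \<open>J' \<subseteq> Y\<close> that cover
  every element equally often. To get them, the part \<open>R\<close> of \<open>I\<close> outside of \<open>X\<close> has to be swapped for a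
  suitable part of \<open>J\<close>, which is the multiple exchange property of matroids (\<open>multiple_exchange\<close>);
  it follows from submodularity of the rank through a partition lemma for two matroids
  (\<open>split_over_two_indeps\<close>). Doing this along the chain (\<open>uncross_chain\<close>) yields an independent
  \<open>A \<subseteq> B\<close>, which is the answer of Alice, and a coloring from the remaining initial lists for the
  remaining weights (\<open>answer_keeps_colorable\<close>). So colorability from initial lists is an invariant
  that Alice can maintain until the end, and (1) implies (3).

  Conversely, a winning strategy yields a coloring from any fixed lists \<open>L\<close>: let Bob present the
  sets \<open>{e. c \<in> L e}\<close> one after the other (\<open>list_colorable_if_online\<close>). So (3) implies (2), and (1) is a
  special case of (2). Finally, a coloring from the lists \<open>{1..k}\<close> with unit weights is the same as
  a partition into at most \<open>k\<close> independent sets, so both chromatic numbers are the same minimum.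
\<close>

section \<open>Rank\<close>

context matroid
begin

definition rank :: "'a set \<Rightarrow> nat" where
  "rank X = Max (card ` {I. I \<subseteq> X \<and> indep I})"

lemma indep_finite: "indep I \<Longrightarrow> finite I"
  using finite_ground finite_subset indep_subset_ground by blast

lemma finite_indep_subsets: "finite {I. I \<subseteq> X \<and> indep I}"
  by (rule finite_subset[of _ "Pow E"]) (use indep_subset_ground finite_ground in auto)

lemma card_le_rank:
  assumes "indep I" "I \<subseteq> X"
  shows "card I \<le> rank X"
  unfolding rank_def using assms finite_indep_subsets by (intro Max_ge) auto

lemma rank_attained: "\<exists>I\<subseteq>X. indep I \<and> card I = rank X"
proof -
  have "rank X \<in> card ` {I. I \<subseteq> X \<and> indep I}"
    unfolding rank_def by (rule Max_in) (use finite_indep_subsets indep_empty in auto)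
  then show ?thesis by auto
qed

lemma rank_mono: "X \<subseteq> Y \<Longrightarrow> rank X \<le> rank Y"
  using rank_attained[of X] card_le_rank[of _ Y] by (metis order_trans)

lemma rank_indep: "indep I \<Longrightarrow> rank I = card I"
  using rank_attained[of I] card_le_rank[of I I] card_mono[OF indep_finite]
  by (metis order_antisym order_refl)

lemma indep_if_card_le_rank:
  assumes "finite X" "card X \<le> rank X"
  shows "indep X"
  using rank_attained[of X] assms card_seteq by metis

lemma indep_extends_to_rank:
  assumes "indep I" "I \<subseteq> X"
  shows "\<exists>K. I \<subseteq> K \<and> K \<subseteq> X \<and> indep K \<and> card K = rank X"
  using assms
proof (induction "rank X - card I" arbitrary: I rule: less_induct)
  case less
  show ?case
  proof (cases "card I = rank X")
    case True
    then show ?thesis using less.prems by blast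
  next
    case False
    then have lt: "card I < rank X" using card_le_rank less.prems by (simp add: order.strict_iff_order)
    obtain J where J: "J \<subseteq> X" "indep J" "card J = rank X" using rank_attained by blast
    obtain y where y: "y \<in> J - I" "indep (insert y I)"
      using augmentation[OF less.prems(1) J(2)] lt J(3) by auto
    have "card (insert y I) = Suc (card I)" using y less.prems indep_finite by auto
    then have "rank X - card (insert y I) < rank X - card I" using lt by simp
    from less.hyps[OF this y(2)]
    obtain K where "insert y I \<subseteq> K" "K \<subseteq> X" "indep K" "card K = rank X"
      using y(1) J(1) less.prems by blast
    then show ?thesis by blast
  qed
qed

text \<open>
  A maximal independent subset of \<open>X \<inter> Y\<close> is extended to one of \<open>X \<union> Y\<close>; the traces of the latter
  on \<open>X\<close> and \<open>Y\<close> are independent and overlap at least in the former.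
\<close>
lemma rank_submodular: "rank (X \<union> Y) + rank (X \<inter> Y) \<le> rank X + rank Y"
proof -
  obtain I where I: "I \<subseteq> X \<inter> Y" "indep I" "card I = rank (X \<inter> Y)"
    using rank_attained by blast
  obtain K where K: "I \<subseteq> K" "K \<subseteq> X \<union> Y" "indep K" "card K = rank (X \<union> Y)"
    using indep_extends_to_rank[of I "X \<union> Y"] I by blast
  have fin: "finite K" using K indep_finite by blast
  have "card K + card I \<le> card ((K \<inter> X) \<union> (K \<inter> Y)) + card ((K \<inter> X) \<inter> (K \<inter> Y))"
    by (intro add_mono card_mono) (use K I fin in auto)
  also have "\<dots> = card (K \<inter> X) + card (K \<inter> Y)"
    using card_Un_Int[of "K \<inter> X" "K \<inter> Y"] fin by simp
  also have "\<dots> \<le> rank X + rank Y"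
    by (intro add_mono card_le_rank) (use K indep_subset in auto)
  finally show ?thesis using K I by simp
qed

text \<open>
  Since \<open>S\<close> is a basis of \<open>X\<close>, it can stand for \<open>X\<close> in every rank. This replaces contraction of \<open>X\<close>
  in the induction below.
\<close>
lemma rank_Un_spanning:
  assumes "indep S" "S \<subseteq> X" "card S = rank X"
  shows "rank (W \<union> X) \<le> rank (W \<union> S)"
proof -
  have "rank ((W \<union> S) \<union> X) + rank ((W \<union> S) \<inter> X) \<le> rank (W \<union> S) + rank X"
    by (rule rank_submodular)
  moreover have "card S \<le> rank ((W \<union> S) \<inter> X)"
    by (rule card_le_rank) (use assms in auto)
  moreover have "rank (W \<union> X) \<le> rank ((W \<union> S) \<union> X)"
    by (rule rank_mono) auto
  ultimately show ?thesis using assms by simp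
qed

section \<open>Multiple exchange\<close>

text \<open>
  This is the substantial half of the matroid partition theorem for the contractions of the matroid
  by \<open>P\<close> and by \<open>R\<close>: the ground set \<open>J\<close> is the union of an independent set of the first and one of
  the second as soon as the two ranks of every \<open>U \<subseteq> J\<close> add up to at least \<open>card U\<close>. It is stated without contractions by
  keeping \<open>P\<close> and \<open>R\<close> inside the ranks. The proof is by induction on \<open>J\<close>. A proper non-empty \<open>U\<close> that
  attains equality is split first; then the parts span \<open>U\<close> over \<open>P\<close> and over \<open>R\<close>, so the condition
  survives for \<open>J - U\<close>. If there is no such \<open>U\<close>, any single element may be put on a side where it is
  independent, because the slack of at least 1 pays for it.
\<close>
lemma split_over_two_indeps:
  assumes "indep P" "indep R" "finite J"
    and "\<And>U. U \<subseteq> J \<Longrightarrow> card P + card R + card U \<le> rank (U \<union> P) + rank (U \<union> R)"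
  shows "\<exists>A D. A \<union> D = J \<and> A \<inter> D = {} \<and> A \<inter> P = {} \<and> D \<inter> R = {} \<and>
    indep (P \<union> A) \<and> indep (R \<union> D)"
  using assms
proof (induction "card J" arbitrary: J P R rule: less_induct)
  case less
  note rank_cond = less.prems(4)
  consider "J = {}"
    | (tight) U where "U \<subset> J" "U \<noteq> {}"
        "rank (U \<union> P) + rank (U \<union> R) = card P + card R + card U"
    | (slack) "J \<noteq> {}" "\<forall>U. U \<subset> J \<longrightarrow> U \<noteq> {} \<longrightarrow>
        card P + card R + card U < rank (U \<union> P) + rank (U \<union> R)"
    using rank_cond
    by (metis order_le_imp_less_or_eq psubset_imp_subset)
  then show ?case
  proof cases
    case 1
    then show ?thesis using less.prems by auto
  next
    case tight
    have finU: "finite U" and lt: "card U < card J"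
      using tight less.prems finite_subset psubset_card_mono by blast+
    obtain A1 D1 where AD1: "A1 \<union> D1 = U" "A1 \<inter> D1 = {}" "A1 \<inter> P = {}" "D1 \<inter> R = {}"
        "indep (P \<union> A1)" "indep (R \<union> D1)"
      using less.hyps[OF lt less.prems(1,2) finU] rank_cond tight by blast
    have cards: "card (P \<union> A1) = card P + card A1" "card (R \<union> D1) = card R + card D1"
      using AD1 indep_finite by (subst card_Un_disjoint; auto)+
    have cardU: "card U = card A1 + card D1"
      using AD1 finU by (metis card_Un_disjoint finite_Un)
    have "card (P \<union> A1) \<le> rank (U \<union> P)" "card (R \<union> D1) \<le> rank (U \<union> R)"
      by (rule card_le_rank; use AD1 in auto)+
    \<comment> \<open>Tightness of \<open>U\<close> forces equality in both bounds, so the two sides are bases.\<close>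
    then have span: "card (P \<union> A1) = rank (U \<union> P)" "card (R \<union> D1) = rank (U \<union> R)"
      using cards cardU tight by linarith+
    have lt2: "card (J - U) < card J"
      using tight less.prems by (intro psubset_card_mono) auto
    have "\<exists>A D. A \<union> D = J - U \<and> A \<inter> D = {} \<and> A \<inter> (P \<union> A1) = {} \<and> D \<inter> (R \<union> D1) = {} \<and>
        indep ((P \<union> A1) \<union> A) \<and> indep ((R \<union> D1) \<union> D)"
    proof (rule less.hyps[OF lt2 AD1(5,6)])
      show "finite (J - U)" using less.prems by auto
      fix W assume W: "W \<subseteq> J - U"
      have "card P + card R + card (W \<union> U) \<le> rank ((W \<union> U) \<union> P) + rank ((W \<union> U) \<union> R)"
        by (rule rank_cond) (use W tight in auto)
      moreover have "card (W \<union> U) = card W + card U"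
        using W finU less.prems(3) by (intro card_Un_disjoint) (auto intro: finite_subset[of W J])
      moreover have "rank (W \<union> (U \<union> P)) \<le> rank (W \<union> (P \<union> A1))"
        by (rule rank_Un_spanning) (use AD1 span in auto)
      moreover have "rank (W \<union> (U \<union> R)) \<le> rank (W \<union> (R \<union> D1))"
        by (rule rank_Un_spanning) (use AD1 span in auto)
      ultimately show "card (P \<union> A1) + card (R \<union> D1) + card W
          \<le> rank (W \<union> (P \<union> A1)) + rank (W \<union> (R \<union> D1))"
        using cards cardU by (simp add: Un_assoc)
    qed
    then obtain A2 D2 where AD2: "A2 \<union> D2 = J - U" "A2 \<inter> D2 = {}"
        "A2 \<inter> (P \<union> A1) = {}" "D2 \<inter> (R \<union> D1) = {}"
        "indep ((P \<union> A1) \<union> A2)" "indep ((R \<union> D1) \<union> D2)"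
      by blast
    show ?thesis
    proof (intro exI conjI)
      show "(A1 \<union> A2) \<union> (D1 \<union> D2) = J" using AD1 AD2 tight by auto
      show "(A1 \<union> A2) \<inter> (D1 \<union> D2) = {}" using AD1 AD2 by auto
      show "(A1 \<union> A2) \<inter> P = {}" "(D1 \<union> D2) \<inter> R = {}" using AD1 AD2 by auto
      show "indep (P \<union> (A1 \<union> A2))" "indep (R \<union> (D1 \<union> D2))"
        using AD2 by (simp_all add: Un_assoc)
    qed
  next
    case slack
    then obtain j where j: "j \<in> J" by blast
    have lt: "card (J - {j}) < card J" using j less.prems by (intro psubset_card_mono) auto
    \<comment> \<open>Stated for an arbitrary pair, since \<open>j\<close> may have to go to either of the two sides.\<close>
    have put: "\<exists>A D. A \<union> D = J - {j} \<and> A \<inter> D = {} \<and> A \<inter> insert j P' = {} \<and> D \<inter> R' = {} \<and>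
        indep (insert j P' \<union> A) \<and> indep (R' \<union> D)" and put_fresh: "j \<notin> P'"
      if P': "indep P'" and R': "indep R'" and gt: "card P' < rank (insert j P')"
        and strict: "\<forall>U. U \<subset> J \<longrightarrow> U \<noteq> {} \<longrightarrow>
          card P' + card R' + card U < rank (U \<union> P') + rank (U \<union> R')"
      for P' R'
    proof -
      show j': "j \<notin> P'" using gt rank_indep[OF P'] by (auto simp: insert_absorb)
      then have c: "card (insert j P') = Suc (card P')" using P' indep_finite by auto
      then have ind: "indep (insert j P')"
        using gt P' indep_finite by (intro indep_if_card_le_rank) auto
      show "\<exists>A D. A \<union> D = J - {j} \<and> A \<inter> D = {} \<and> A \<inter> insert j P' = {} \<and> D \<inter> R' = {} \<and>
        indep (insert j P' \<union> A) \<and> indep (R' \<union> D)"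
      proof (rule less.hyps[OF lt ind R'])
        show "finite (J - {j})" using less.prems by auto
        fix U assume U: "U \<subseteq> J - {j}"
        show "card (insert j P') + card R' + card U \<le> rank (U \<union> insert j P') + rank (U \<union> R')"
        proof (cases "U = {}")
          case True
          then show ?thesis using rank_indep ind R' by simp
        next
          case False
          have "rank (U \<union> P') \<le> rank (U \<union> insert j P')" by (rule rank_mono) auto
          moreover have "card P' + card R' + card U < rank (U \<union> P') + rank (U \<union> R')"
            using strict U False j by blast
          ultimately show ?thesis using c by linarith
        qed
      qed
    qed
    have "card P + card R < rank (insert j P) + rank (insert j R)"
      using rank_cond[of "{j}"] j by auto
    then consider "card P < rank (insert j P)" | "card R < rank (insert j R)" by linarith
    then show ?thesis
    proof cases
      case 1
      obtain A D where "A \<union> D = J - {j}" "A \<inter> D = {}" "A \<inter> insert j P = {}" "D \<inter> R = {}"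
          "indep (insert j P \<union> A)" "indep (R \<union> D)"
        using put[OF less.prems(1,2) 1 slack(2)] by (elim exE conjE) (rule that)
      then show ?thesis
        using put_fresh[OF less.prems(1,2) 1 slack(2)] j
        by (intro exI[of _ "insert j A"] exI[of _ D]) auto
    next
      case 2
      have slack': "\<forall>U. U \<subset> J \<longrightarrow> U \<noteq> {} \<longrightarrow>
          card R + card P + card U < rank (U \<union> R) + rank (U \<union> P)"
        using slack(2) by (simp add: add.commute)
      obtain A D where "A \<union> D = J - {j}" "A \<inter> D = {}" "A \<inter> insert j R = {}" "D \<inter> P = {}"
          "indep (insert j R \<union> A)" "indep (P \<union> D)"
        using put[OF less.prems(2,1) 2 slack'] by (elim exE conjE) (rule that)
      then show ?thesis
        using put_fresh[OF less.prems(2,1) 2 slack'] j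
        by (intro exI[of _ D] exI[of _ "insert j A"]) auto
    qed
  qed
qed

text \<open>
  \<open>R\<close> leaves \<open>I\<close> and joins \<open>J\<close>, while in return a part \<open>A\<close> of \<open>J\<close> moves to \<open>I\<close>. The disjointness
  conditions say that no element gets lost in the exchange when elements are counted with
  multiplicity. The rank condition of the preceding lemma holds by submodularity, since the union
  of \<open>U \<union> (I - R)\<close> and \<open>U \<union> R\<close> contains \<open>I\<close> and their intersection contains \<open>U\<close>.
\<close>
lemma multiple_exchange:
  assumes I: "indep I" and J: "indep J" and R: "R \<subseteq> I"
  shows "\<exists>A D. A \<union> D = J \<and> A \<inter> D = {} \<and> A \<inter> (I - R) = {} \<and> D \<inter> R = {} \<and>
    indep ((I - R) \<union> A) \<and> indep (R \<union> D)"
proof (rule split_over_two_indeps)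
  show "indep (I - R)" "indep R" using I R indep_subset by blast+
  show "finite J" using J indep_finite by blast
  fix U assume U: "U \<subseteq> J"
  have "card I \<le> rank ((U \<union> (I - R)) \<union> (U \<union> R))"
    by (rule card_le_rank) (use I in auto)
  moreover have "card U \<le> rank ((U \<union> (I - R)) \<inter> (U \<union> R))"
    by (rule card_le_rank) (use J U indep_subset in auto)
  moreover have "card (I - R) + card R = card I"
    using R I indep_finite
    by (metis Nat.le_imp_diff_is_add add.commute card_Diff_subset card_mono finite_subset)
  ultimately show "card (I - R) + card R + card U \<le> rank (U \<union> (I - R)) + rank (U \<union> R)"
    using rank_submodular[of "U \<union> (I - R)" "U \<union> R"] by linarith
qed

section \<open>One round of the game\<close>

text \<open>
  Going down the chain from its end, a set \<open>W \<subseteq> Q\<^sub>i\<^sub>+\<^sub>1 \<inter> B\<close> is carried along. At index \<open>i\<close> the part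
  \<open>R\<close> of \<open>V\<^sub>i\<close> that does not fit into \<open>(Q\<^sub>i - B) \<union> (Q\<^sub>i\<^sub>+\<^sub>1 \<inter> B)\<close> is pushed into \<open>W\<close>, and in exchange some
  elements of \<open>W\<close> settle in the new \<open>i\<close>-th set, where they always fit. The set that is carried out
  of index 0 is \<open>A\<close>.
\<close>
lemma uncross_chain:
  fixes V Q :: "nat \<Rightarrow> 'a set"
  assumes "\<And>i. i < n \<Longrightarrow> indep (V i) \<and> V i \<subseteq> Q i" and "\<And>i. Q (Suc i) \<subseteq> Q i"
  shows "\<exists>A V'. indep A \<and> A \<subseteq> B \<inter> Q 0 \<and>
    (\<forall>i<n. indep (V' i) \<and> V' i \<subseteq> (Q i - B) \<union> (Q (Suc i) \<inter> B)) \<and>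
    (\<forall>e. (\<Sum>i<n. of_bool (e \<in> V i)) = of_bool (e \<in> A) + (\<Sum>i<n. of_bool (e \<in> V' i) :: nat))"
  using assms
proof (induction n arbitrary: V Q)
  case 0
  then show ?case using indep_empty by auto
next
  case (Suc n)
  have "\<exists>A V'. indep A \<and> A \<subseteq> B \<inter> Q (Suc 0) \<and>
    (\<forall>i<n. indep (V' i) \<and> V' i \<subseteq> (Q (Suc i) - B) \<union> (Q (Suc (Suc i)) \<inter> B)) \<and>
    (\<forall>e. (\<Sum>i<n. of_bool (e \<in> V (Suc i)))
        = of_bool (e \<in> A) + (\<Sum>i<n. of_bool (e \<in> V' i) :: nat))"
    using Suc.prems by (intro Suc.IH[of "\<lambda>i. V (Suc i)" "\<lambda>i. Q (Suc i)"]) auto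
  then obtain W V' where W: "indep W" "W \<subseteq> B \<inter> Q (Suc 0)"
    and V': "\<And>i. i < n \<Longrightarrow> indep (V' i) \<and> V' i \<subseteq> (Q (Suc i) - B) \<union> (Q (Suc (Suc i)) \<inter> B)"
    and count: "\<And>e. (\<Sum>i<n. of_bool (e \<in> V (Suc i)))
        = of_bool (e \<in> W) + (\<Sum>i<n. of_bool (e \<in> V' i) :: nat)"
    by blast
  have V0: "indep (V 0)" "V 0 \<subseteq> Q 0" using Suc.prems by auto
  define R where "R = V 0 \<inter> B - Q (Suc 0)"
  have R: "R \<subseteq> V 0" by (auto simp: R_def)
  obtain A D where AD: "A \<union> D = W" "A \<inter> D = {}" "A \<inter> (V 0 - R) = {}" "D \<inter> R = {}"
      "indep ((V 0 - R) \<union> A)" "indep (R \<union> D)"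
    using multiple_exchange[OF V0(1) W(1) R] by (elim exE conjE) (rule that)
  show ?case
  proof (intro exI conjI allI impI)
    show "indep (R \<union> D)" by fact
    show "R \<union> D \<subseteq> B \<inter> Q 0" using W AD(1) V0 Suc.prems(2)[of 0] by (auto simp: R_def)
    fix i assume "i < Suc n"
    then show "indep (case_nat ((V 0 - R) \<union> A) V' i)"
      using AD V' by (cases i) auto
    show "case_nat ((V 0 - R) \<union> A) V' i \<subseteq> (Q i - B) \<union> (Q (Suc i) \<inter> B)"
      using AD(1) V' W V0 \<open>i < Suc n\<close> by (cases i) (auto simp: R_def)
  next
    fix e
    have "of_bool (e \<in> V 0) + of_bool (e \<in> W)
        = of_bool (e \<in> R \<union> D) + (of_bool (e \<in> (V 0 - R) \<union> A) :: nat)"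
      using AD(1-4) R by (auto simp: of_bool_def)
    then show "(\<Sum>i<Suc n. of_bool (e \<in> V i)) = of_bool (e \<in> R \<union> D)
        + (\<Sum>i<Suc n. of_bool (e \<in> case_nat ((V 0 - R) \<union> A) V' i) :: nat)"
      using count[of e] by (simp add: sum.lessThan_Suc_shift del: sum.lessThan_Suc)
  qed
qed

text \<open>
  The color classes of a coloring from initial lists, with color \<open>Suc i\<close> at index \<open>i\<close>. The chain
  \<open>{e \<in> E. i < ell e}\<close> becomes visible in this form.
\<close>
lemma initial_lists_colorable_iff:
  "list_colorable E indep w (\<lambda>e. {1..ell e}) \<longleftrightarrow>
    (\<exists>n V. (\<forall>i<n. indep (V i) \<and> V i \<subseteq> {e \<in> E. i < ell e}) \<and>
       (\<forall>e\<in>E. w e = (\<Sum>i<n. of_bool (e \<in> V i))))"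
  (is "?L \<longleftrightarrow> ?R")
proof
  assume ?L
  then obtain L' where L': "\<And>e. e \<in> E \<Longrightarrow> L' e \<subseteq> {1..ell e}" "\<And>e. e \<in> E \<Longrightarrow> card (L' e) = w e"
      "\<And>c. indep {e\<in>E. c \<in> L' e}"
    unfolding list_colorable_def by blast
  \<comment> \<open>Any common upper bound of the list sizes would do.\<close>
  define n where "n = (\<Sum>e\<in>E. ell e)"
  show ?R
  proof (intro exI conjI allI impI ballI)
    fix i
    show "indep {e\<in>E. Suc i \<in> L' e}" by (rule L')
    show "{e\<in>E. Suc i \<in> L' e} \<subseteq> {e \<in> E. i < ell e}" using L'(1) by fastforce
  next
    fix e assume e: "e \<in> E"
    have "ell e \<le> n" unfolding n_def using e finite_ground by (intro member_le_sum) auto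
    then have "L' e = Suc ` {i\<in>{..<n}. Suc i \<in> L' e}"
      using L'(1)[OF e] by (auto simp: image_iff) (metis Suc_le_D Suc_le_eq atLeastAtMost_iff order_trans subset_iff)
    then have "w e = card {i\<in>{..<n}. Suc i \<in> L' e}"
      using L'(2)[OF e] card_image[of Suc] by (metis inj_Suc)
    also have "\<dots> = (\<Sum>i<n. of_bool (Suc i \<in> L' e))"
      by (simp add: Collect_conj_eq lessThan_def)
    finally show "w e = (\<Sum>i<n. of_bool (e \<in> {e\<in>E. Suc i \<in> L' e}))"
      using e by simp
  qed
next
  assume ?R
  then obtain n V where V: "\<And>i. i < n \<Longrightarrow> indep (V i)" "\<And>i. i < n \<Longrightarrow> V i \<subseteq> {e \<in> E. i < ell e}"
      and w: "\<And>e. e \<in> E \<Longrightarrow> w e = (\<Sum>i<n. of_bool (e \<in> V i))"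
    by blast
  define L' where "L' e = Suc ` {i\<in>{..<n}. e \<in> V i}" for e
  show ?L unfolding list_colorable_def
  proof (intro exI[of _ L'] conjI ballI allI)
    fix e assume e: "e \<in> E"
    show "L' e \<subseteq> {1..ell e}" using V(2) by (force simp: L'_def)
    show "finite (L' e)" by (simp add: L'_def)
    show "card (L' e) = w e"
      using w[OF e] by (simp add: L'_def card_image Collect_conj_eq lessThan_def)
  next
    fix c
    show "indep {e\<in>E. c \<in> L' e}"
    proof (cases "c \<in> Suc ` {..<n}")
      case True
      then have "indep (V (c - 1))" "{e\<in>E. c \<in> L' e} \<subseteq> V (c - 1)"
        using V(1) by (auto simp: L'_def)
      then show ?thesis by (rule indep_subset)
    next
      case False
      then have "{e\<in>E. c \<in> L' e} = {}" by (auto simp: L'_def)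
      then show ?thesis by (simp only: indep_empty)
    qed
  qed
qed

text \<open>
  The invariant of the winning strategy: Alice can answer such that the rest of the game, with list
  sizes lowered on \<open>B\<close> and weights lowered on \<open>A\<close>, satisfies the hypothesis again. Positivity of \<open>w\<close>
  on \<open>A\<close> ensures that no truncated difference occurs.
\<close>
lemma answer_keeps_colorable:
  assumes "list_colorable E indep w (\<lambda>e. {1..ell e})"
    and B: "B \<subseteq> E" "\<And>e. e \<in> B \<Longrightarrow> 0 < ell e"
  shows "\<exists>A\<subseteq>B. indep A \<and> (\<forall>e\<in>A. 0 < w e) \<and>
    list_colorable E indep (\<lambda>e. w e - of_bool (e \<in> A)) (\<lambda>e. {1..ell e - of_bool (e \<in> B)})"
proof -
  define Q where "Q i = {e \<in> E. i < ell e}" for i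
  obtain n V where V: "\<And>i. i < n \<Longrightarrow> indep (V i) \<and> V i \<subseteq> Q i"
      and w: "\<And>e. e \<in> E \<Longrightarrow> w e = (\<Sum>i<n. of_bool (e \<in> V i))"
    using assms(1) unfolding initial_lists_colorable_iff Q_def by blast
  have "Q (Suc i) \<subseteq> Q i" for i by (auto simp: Q_def)
  from uncross_chain[of n V Q B, OF V this]
  obtain A V' where A: "indep A" "A \<subseteq> B \<inter> Q 0"
    and V': "\<And>i. i < n \<Longrightarrow> indep (V' i) \<and> V' i \<subseteq> (Q i - B) \<union> (Q (Suc i) \<inter> B)"
    and count: "\<And>e. (\<Sum>i<n. of_bool (e \<in> V i))
        = of_bool (e \<in> A) + (\<Sum>i<n. of_bool (e \<in> V' i) :: nat)"
    by blast
  have w': "w e = of_bool (e \<in> A) + (\<Sum>i<n. of_bool (e \<in> V' i))" if "e \<in> E" for e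
    using w[OF that] count by simp
  have "list_colorable E indep (\<lambda>e. w e - of_bool (e \<in> A)) (\<lambda>e. {1..ell e - of_bool (e \<in> B)})"
    unfolding initial_lists_colorable_iff
  proof (intro exI conjI allI impI ballI)
    fix i assume i: "i < n"
    show "indep (V' i)" using V'[OF i] by blast
    show "V' i \<subseteq> {e \<in> E. i < ell e - of_bool (e \<in> B)}"
      using V'[OF i] by (force simp: Q_def)
  next
    fix e assume "e \<in> E"
    then show "w e - of_bool (e \<in> A) = (\<Sum>i<n. of_bool (e \<in> V' i))"
      using w' by simp
  qed
  moreover have "\<forall>e\<in>A. 0 < w e"
  proof
    fix e assume "e \<in> A"
    then show "0 < w e" using w'[of e] A B by auto
  qed
  ultimately show ?thesis using A by blast
qed

end

section \<open>The game\<close>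

lemma colors_of_Nil: "colors_of [] e = {}"
  by (simp add: colors_of_def)

lemma card_colors_of: "card (colors_of Xs e) = card {i. i < length Xs \<and> e \<in> Xs ! i}"
proof -
  have "colors_of Xs e = Suc ` {i. i < length Xs \<and> e \<in> Xs ! i}"
    by (auto simp: colors_of_def)
  then show ?thesis by (simp add: card_image)
qed

lemma card_colors_of_Cons:
  "card (colors_of (X # Xs) e) = of_bool (e \<in> X) + card (colors_of Xs e)"
proof -
  have "{i. i < length (X # Xs) \<and> e \<in> (X # Xs) ! i}
      = (if e \<in> X then {0} else {}) \<union> Suc ` {i. i < length Xs \<and> e \<in> Xs ! i}"
    by (auto simp: less_Suc_eq_0_disj)
  then show ?thesis
    unfolding card_colors_of by (auto simp: card_image card_insert_if)
qed

lemma bob_legal_Cons: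
  "bob_legal E ell (B # Bs) \<longleftrightarrow> B \<noteq> {} \<and> B \<subseteq> E \<and> (\<forall>e\<in>B. 0 < ell e) \<and>
    bob_legal E (\<lambda>e. ell e - of_bool (e \<in> B)) Bs"
proof -
  have "of_bool P + m \<le> k \<longleftrightarrow> (P \<longrightarrow> 0 < k) \<and> m \<le> k - of_bool P" for P and m k :: nat
    by (cases P) auto
  then show ?thesis unfolding bob_legal_def card_colors_of_Cons by auto
qed

lemma game_over_Cons:
  assumes "\<forall>e\<in>B. 0 < ell e"
  shows "game_over E ell (B # Bs) \<longleftrightarrow> game_over E (\<lambda>e. ell e - of_bool (e \<in> B)) Bs"
proof -
  have "of_bool (e \<in> B) + m = ell e \<longleftrightarrow> m = ell e - of_bool (e \<in> B)" for e m
    using assms by (cases "e \<in> B") auto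
  then show ?thesis unfolding game_over_def card_colors_of_Cons by auto
qed

lemma alice_moves_Cons:
  "alice_moves \<sigma> (B # Bs) = \<sigma> [B] # alice_moves (\<lambda>Cs. \<sigma> (B # Cs)) Bs"
  by (rule nth_equalityI) (auto simp: alice_moves_def nth_Cons simp del: upt_Suc split: nat.split)

text \<open>
  After the first round the players play the same kind of game for smaller lists and weights. A
  strategy consists of an answer to each possible first move together with a strategy for the game
  that remains after it.
\<close>
lemma online_colorable_step:
  assumes no_rounds: "(\<forall>e\<in>E. ell e = 0) \<Longrightarrow> (\<forall>e\<in>E. w e = 0)"
    and step: "\<And>B. B \<noteq> {} \<Longrightarrow> B \<subseteq> E \<Longrightarrow> \<forall>e\<in>B. 0 < ell e \<Longrightarrow>
      \<exists>A\<subseteq>B. indep A \<and> (\<forall>e\<in>A. 0 < w e) \<and>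
        online_colorable E indep (\<lambda>e. w e - of_bool (e \<in> A)) (\<lambda>e. ell e - of_bool (e \<in> B))"
  shows "online_colorable E indep w ell"
proof -
  define good_reply where "good_reply B A \<tau> \<longleftrightarrow>
      A \<subseteq> B \<and> indep A \<and> (\<forall>e\<in>A. 0 < w e) \<and>
      winning_strategy E indep (\<lambda>e. w e - of_bool (e \<in> A)) (\<lambda>e. ell e - of_bool (e \<in> B)) \<tau>"
    for B A \<tau>
  have "\<forall>B. \<exists>A \<tau>. B \<noteq> {} \<and> B \<subseteq> E \<and> (\<forall>e\<in>B. 0 < ell e) \<longrightarrow> good_reply B A \<tau>"
    using step unfolding online_colorable_def good_reply_def by meson
  then obtain a \<tau> where reply: "\<And>B. B \<noteq> {} \<Longrightarrow> B \<subseteq> E \<Longrightarrow> \<forall>e\<in>B. 0 < ell e \<Longrightarrow>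
      good_reply B (a B) (\<tau> B)"
    by metis
  define \<sigma> where
    "\<sigma> Bs = (case Bs of [] \<Rightarrow> {} | B # Cs \<Rightarrow> if Cs = [] then a B else \<tau> B Cs)" for Bs
  have moves: "alice_moves \<sigma> (B # Bs) = a B # alice_moves (\<tau> B) Bs" for B Bs
  proof -
    have "alice_moves (\<lambda>Cs. \<sigma> (B # Cs)) Bs = alice_moves (\<tau> B) Bs"
      by (auto simp: alice_moves_def \<sigma>_def)
    then show ?thesis by (simp add: alice_moves_Cons) (simp add: \<sigma>_def)
  qed
  have "winning_strategy E indep w ell \<sigma>"
    unfolding winning_strategy_def
  proof (intro allI impI)
    fix Bs assume legal: "bob_legal E ell Bs"
    show "list_all2 (\<lambda>A B. A \<subseteq> B \<and> indep A) (alice_moves \<sigma> Bs) Bs \<and>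
       (game_over E ell Bs \<longrightarrow> (\<forall>e\<in>E. card (colors_of (alice_moves \<sigma> Bs) e) = w e))"
    proof (cases Bs)
      case Nil
      then show ?thesis
        using no_rounds by (auto simp: alice_moves_def game_over_def colors_of_Nil)
    next
      case (Cons B Cs)
      have B: "B \<noteq> {}" "B \<subseteq> E" "\<forall>e\<in>B. 0 < ell e"
        and legal': "bob_legal E (\<lambda>e. ell e - of_bool (e \<in> B)) Cs"
        using legal unfolding Cons bob_legal_Cons by auto
      note win = reply[OF B, unfolded good_reply_def]
      then have rest: "list_all2 (\<lambda>A B. A \<subseteq> B \<and> indep A) (alice_moves (\<tau> B) Cs) Cs"
        and fin: "game_over E (\<lambda>e. ell e - of_bool (e \<in> B)) Cs \<Longrightarrow>
          \<forall>e\<in>E. card (colors_of (alice_moves (\<tau> B) Cs) e) = w e - of_bool (e \<in> a B)"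
        using legal' unfolding winning_strategy_def by blast+
      have pos: "of_bool (e \<in> a B) \<le> w e" for e
        using win by (cases "e \<in> a B") (auto simp: Suc_le_eq)
      show ?thesis
        unfolding Cons moves game_over_Cons[OF B(3)] card_colors_of_Cons
        using rest fin win pos by simp
    qed
  qed
  then show ?thesis unfolding online_colorable_def by blast
qed

lemma (in matroid) online_colorable_if_initial_lists:
  assumes "list_colorable E indep w (\<lambda>e. {1..ell e})"
  shows "online_colorable E indep w ell"
  using assms
proof (induction "\<Sum>e\<in>E. ell e" arbitrary: w ell rule: less_induct)
  case less
  show ?case
  proof (rule online_colorable_step)
    assume "\<forall>e\<in>E. ell e = 0"
    then show "\<forall>e\<in>E. w e = 0" using less.prems unfolding list_colorable_def by fastforce
  next
    fix B assume B: "B \<noteq> {}" "B \<subseteq> E" "\<forall>e\<in>B. 0 < ell e"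
    obtain A where A: "A \<subseteq> B" "indep A" "\<forall>e\<in>A. 0 < w e"
      "list_colorable E indep (\<lambda>e. w e - of_bool (e \<in> A)) (\<lambda>e. {1..ell e - of_bool (e \<in> B)})"
      using answer_keeps_colorable[OF less.prems B(2)] B(3) by blast
    obtain b where "b \<in> B" using B by blast
    then have "(\<Sum>e\<in>E. ell e - of_bool (e \<in> B)) < (\<Sum>e\<in>E. ell e)"
      using B finite_ground by (intro sum_strict_mono_ex1) (auto intro!: bexI[of _ b])
    from less.hyps[OF this A(4)] A
    show "\<exists>A\<subseteq>B. indep A \<and> (\<forall>e\<in>A. 0 < w e) \<and>
        online_colorable E indep (\<lambda>e. w e - of_bool (e \<in> A)) (\<lambda>e. ell e - of_bool (e \<in> B))"
      by blast
  qed
qed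

text \<open>
  Bob announces in advance that he will present the color classes of \<open>L\<close>. The \<open>i\<close>-th round is about
  the \<open>i\<close>-th color of an enumeration \<open>cs\<close> of the colors that occur in \<open>L\<close>, so all his moves are
  non-empty; the answers of Alice are the color classes of the coloring.
\<close>
lemma (in matroid) list_colorable_if_online:
  assumes "online_colorable E indep w ell"
    and L: "\<forall>e\<in>E. finite (L e) \<and> card (L e) = ell e"
  shows "list_colorable E indep w L"
proof -
  obtain \<sigma> where \<sigma>: "winning_strategy E indep w ell \<sigma>"
    using assms(1) unfolding online_colorable_def by blast
  define cs where "cs = sorted_list_of_set (\<Union>e\<in>E. L e)"
  have set_cs: "set cs = (\<Union>e\<in>E. L e)" and distinct: "distinct cs"
    using L finite_ground by (auto simp: cs_def)
  define Bs where "Bs = map (\<lambda>c. {e\<in>E. c \<in> L e}) cs"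
  define As where "As = alice_moves \<sigma> Bs"
  have len: "length As = length cs" by (simp add: As_def alice_moves_def Bs_def)
  have inj: "inj_on ((!) cs) I" if "I \<subseteq> {..<length cs}" for I
    using that distinct by (intro inj_on_nth) auto
  have ell: "card (colors_of Bs e) = ell e" if e: "e \<in> E" for e
  proof -
    define I where "I = {i. i < length Bs \<and> e \<in> Bs ! i}"
    have "L e = (!) cs ` I"
    proof (intro equalityI subsetI)
      fix c assume c: "c \<in> L e"
      then have "c \<in> set cs" using set_cs e by blast
      then obtain i where "i < length cs" "cs ! i = c" by (auto simp: in_set_conv_nth)
      then show "c \<in> (!) cs ` I" using c e by (intro image_eqI[of _ _ i]) (auto simp: I_def Bs_def)
    qed (auto simp: I_def Bs_def)
    moreover have "inj_on ((!) cs) I" by (rule inj) (auto simp: I_def Bs_def)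
    ultimately have "card (L e) = card I" by (simp add: card_image)
    then show ?thesis using L e by (simp add: card_colors_of I_def)
  qed
  have "B \<noteq> {} \<and> B \<subseteq> E" if "B \<in> set Bs" for B
    using that set_cs by (auto simp: Bs_def)
  then have "bob_legal E ell Bs" "game_over E ell Bs"
    using ell by (simp_all add: bob_legal_def game_over_def)
  then have "list_all2 (\<lambda>A B. A \<subseteq> B \<and> indep A) As Bs"
    and w: "\<And>e. e \<in> E \<Longrightarrow> card (colors_of As e) = w e"
    using \<sigma> unfolding winning_strategy_def As_def by blast+
  then have sub: "\<And>i. i < length cs \<Longrightarrow> As ! i \<subseteq> Bs ! i \<and> indep (As ! i)"
    using len by (auto simp: list_all2_conv_all_nth)
  define L' where "L' e = (!) cs ` {i. i < length As \<and> e \<in> As ! i}" for e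
  show ?thesis unfolding list_colorable_def
  proof (intro exI[of _ L'] conjI ballI allI)
    fix e assume e: "e \<in> E"
    show "L' e \<subseteq> L e" using sub len by (fastforce simp: L'_def Bs_def)
    show "finite (L' e)" by (simp add: L'_def)
    have "inj_on ((!) cs) {i. i < length As \<and> e \<in> As ! i}"
      by (rule inj) (auto simp: len)
    then show "card (L' e) = w e"
      using w[OF e] by (simp add: L'_def card_image card_colors_of)
  next
    fix c
    show "indep {e\<in>E. c \<in> L' e}"
    proof (cases "c \<in> set cs")
      case True
      then obtain i where i: "i < length cs" "c = cs ! i" by (auto simp: in_set_conv_nth)
      then have "{e\<in>E. c \<in> L' e} \<subseteq> As ! i"
        using distinct len by (auto simp: L'_def nth_eq_iff_index_eq)
      then show ?thesis using sub i indep_subset by blast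
    next
      case False
      then have "{e\<in>E. c \<in> L' e} = {}" using len by (auto simp: L'_def)
      then show ?thesis by (simp only: indep_empty)
    qed
  qed
qed

section \<open>Chromatic numbers\<close>

text \<open>
  The number of parts may be smaller than \<open>k\<close> because empty color classes are no parts.
\<close>
lemma (in matroid) colorable_by_k_iff_partition:
  "list_colorable E indep (\<lambda>_. 1) (\<lambda>_. {1..k}) \<longleftrightarrow>
    (\<exists>j\<le>k. \<exists>P. partition_on E P \<and> (\<forall>X\<in>P. indep X) \<and> card P = j)"
  (is "?L \<longleftrightarrow> ?R")
proof
  assume ?L
  then obtain L' where L': "\<And>e. e \<in> E \<Longrightarrow> L' e \<subseteq> {1..k}" "\<And>e. e \<in> E \<Longrightarrow> card (L' e) = 1"
      "\<And>c. indep {e\<in>E. c \<in> L' e}"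
    unfolding list_colorable_def by blast
  define col where "col e = the_elem (L' e)" for e
  have col: "L' e = {col e}" if e: "e \<in> E" for e
  proof -
    obtain c where "L' e = {c}" using L'(2)[OF e] by (rule card_1_singletonE)
    then show ?thesis by (simp add: col_def)
  qed
  define X where "X c = {e\<in>E. col e = c}" for c
  define P where "P = X ` {1..k} - {{}}"
  have "partition_on E P"
  proof (rule partition_onI)
    have "col e \<in> {1..k}" if "e \<in> E" for e using L'(1)[OF that] col[OF that] by blast
    then show "\<Union> P = E" unfolding P_def X_def by blast
    show "{} \<notin> P" by (simp add: P_def)
    fix p q assume "p \<in> P" "q \<in> P" "p \<noteq> q"
    then show "disjnt p q" by (auto simp: P_def X_def disjnt_def)
  qed
  moreover have "indep (X c)" for c
  proof -
    have "X c = {e\<in>E. c \<in> L' e}" using col by (auto simp: X_def)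
    then show ?thesis using L'(3) by simp
  qed
  moreover have "card P \<le> k"
  proof -
    have "card P \<le> card (X ` {1..k})" by (intro card_mono) (auto simp: P_def)
    also have "\<dots> \<le> k" using card_image_le[of "{1..k}" X] by simp
    finally show ?thesis .
  qed
  ultimately show ?R by (auto simp: P_def)
next
  assume ?R
  then obtain P where P: "partition_on E P" "\<forall>X\<in>P. indep X" "card P \<le> k" by blast
  have fin: "finite P" using P(1) finite_ground by (rule finite_elements[rotated])
  then obtain f where f: "bij_betw f P {0..<card P}"
    using ex_bij_betw_finite_nat by blast
  define L' where "L' e = Suc ` f ` {X\<in>P. e \<in> X}" for e
  show ?L unfolding list_colorable_def
  proof (intro exI[of _ L'] conjI ballI allI)
    fix e assume e: "e \<in> E"
    then obtain X where X: "X \<in> P" "e \<in> X" using P(1) by (auto simp: partition_on_def)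
    then have single: "{X\<in>P. e \<in> X} = {X}"
      using P(1) by (auto simp: partition_on_def disjoint_def)
    have "f X < card P" using f X by (auto simp: bij_betw_def)
    then show "L' e \<subseteq> {1..k}" using P(3) by (simp add: L'_def single)
    show "finite (L' e)" "card (L' e) = 1" by (simp_all add: L'_def single)
  next
    fix c
    show "indep {e\<in>E. c \<in> L' e}"
    proof (cases "\<exists>X\<in>P. c = Suc (f X)")
      case True
      then obtain X where X: "X \<in> P" "c = Suc (f X)" by blast
      then have "{e\<in>E. c \<in> L' e} \<subseteq> X"
        using f by (auto simp: L'_def bij_betw_def inj_on_def)
      then show ?thesis using P X indep_subset by blast
    next
      case False
      then have "{e\<in>E. c \<in> L' e} = {}" by (auto simp: L'_def)
      then show ?thesis by (simp only: indep_empty)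
    qed
  qed
qed

lemma Least_ex_le:
  fixes Q :: "nat \<Rightarrow> bool"
  shows "(LEAST k. \<exists>j\<le>k. Q j) = (LEAST k. Q k)"
proof (cases "\<exists>k. Q k")
  case True
  then have "Q (LEAST k. Q k)" by (metis LeastI)
  then show ?thesis
    by (intro Least_equality) (auto intro: Least_le order_trans)
qed auto

theorem theorem3p7:
  fixes E :: "'a set" and indep :: "'a set \<Rightarrow> bool" and ell w :: "'a \<Rightarrow> nat"
  assumes "matroid E indep"
  shows "(list_colorable E indep w (\<lambda>e. {1..ell e}) \<longleftrightarrow>
            (\<forall>L :: 'a \<Rightarrow> nat set. (\<forall>e\<in>E. finite (L e) \<and> card (L e) = ell e) \<longrightarrow>
               list_colorable E indep w L)) \<and>
         ((\<forall>L :: 'a \<Rightarrow> nat set. (\<forall>e\<in>E. finite (L e) \<and> card (L e) = ell e) \<longrightarrow>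
               list_colorable E indep w L) \<longleftrightarrow>
            online_colorable E indep w ell) \<and>
         (loopless E indep \<longrightarrow>
            online_list_chromatic_number E indep = chromatic_number E indep)"
proof -
  interpret matroid E indep by fact
  define any_lists where "any_lists w' ell' \<longleftrightarrow>
      (\<forall>L :: 'a \<Rightarrow> nat set. (\<forall>e\<in>E. finite (L e) \<and> card (L e) = ell' e) \<longrightarrow>
        list_colorable E indep w' L)" for w' ell' :: "'a \<Rightarrow> nat"
  have initial: "list_colorable E indep w' (\<lambda>e. {1..ell' e})" if "any_lists w' ell'" for w' ell'
    using that by (simp add: any_lists_def)
  have any: "any_lists w' ell'" if "online_colorable E indep w' ell'" for w' ell'
    unfolding any_lists_def using list_colorable_if_online[OF that] by blast
  have online_iff: "online_colorable E indep w' ell' \<longleftrightarrow>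
      list_colorable E indep w' (\<lambda>e. {1..ell' e})" for w' ell'
    using online_colorable_if_initial_lists initial any by blast
  have "online_list_chromatic_number E indep = chromatic_number E indep"
    unfolding online_list_chromatic_number_def chromatic_number_def online_iff
      colorable_by_k_iff_partition by (rule Least_ex_le)
  moreover have "any_lists w ell \<longleftrightarrow> online_colorable E indep w ell"
    using any initial online_iff by blast
  ultimately show ?thesis using online_iff unfolding any_lists_def by blast
qed

end
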